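(* The normal modal logics $\mathrm{EQ}_1$ and $\mathrm{EQ}_2$ have the uniform interpolation property, whereas $\mathrm{EQ}_n$ for $n\ge3$ does not have the Craig interpolation property. The logics $\mathrm{LO}_n$, $n\geq1$, have the uniform interpolation property.
   Context: Modal formulas over atoms with $\top,\neg,\wedge,\Box$; $\mathrm{sig}$ = set of atoms. $\mathrm{EQ}_n$ is the normal modal logic (set of formulas true at all worlds of all models) of all frames whose accessibility relation is an equivalence relation and which have at most $n$ worlds. $\mathrm{LO}_n$ is the normal modal logic of all frames that are transitive, have no infinite chains $w_0Rw_1R\cdots$, satisfy $\forall w\forall v(wRv\vee vRw\vee w=v)$, and have length at most $n$ (i.e. are strict linear orders with at most $n$ worlds). A logic $L$ has the Craig interpolation property if every $\varphi\to\psi\in L$ has $\chi$ with $\varphi\to\chi,\chi\to\psi\in L$ and $\mathrm{sig}(\chi)\subseteq\mathrm{sig}(\varphi)\cap\mathrm{sig}(\psi)$. $L$ has the uniform interpolation property if for every formula $\varphi$ and signature $\sigma$ there is $\chi$ with $\mathrm{sig}(\chi)\subseteq\sigma$, $\varphi\to\chi\in L$, and $\chi\to\psi\in L$ for all $\psi$ with $\mathrm{sig}(\psi)\cap\mathrm{sig}(\varphi)\subseteq\sigma$ and $\varphi\to\psi\in L$. *)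

theory Defs
  imports Main
begin

datatype (sig: 'a) fm =
    Atom 'a
  | Truth
  | Neg "'a fm"
  | Conj "'a fm" "'a fm"
  | Box "'a fm"

abbreviation Imp :: "'a fm \<Rightarrow> 'a fm \<Rightarrow> 'a fm" where
  "Imp \<phi> \<psi> \<equiv> Neg (Conj \<phi> (Neg \<psi>))"

definition frame :: "'w set \<Rightarrow> ('w \<times> 'w) set \<Rightarrow> bool" where
  "frame W R \<longleftrightarrow> W \<noteq> {} \<and> R \<subseteq> W \<times> W"

primrec holds :: "'w set \<Rightarrow> ('w \<times> 'w) set \<Rightarrow> ('w \<Rightarrow> 'a set) \<Rightarrow> 'w \<Rightarrow> 'a fm \<Rightarrow> bool" where
  "holds W R V w (Atom p) \<longleftrightarrow> p \<in> V w"
| "holds W R V w Truth \<longleftrightarrow> True"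
| "holds W R V w (Neg \<phi>) \<longleftrightarrow> \<not> holds W R V w \<phi>"
| "holds W R V w (Conj \<phi> \<psi>) \<longleftrightarrow> holds W R V w \<phi> \<and> holds W R V w \<psi>"
| "holds W R V w (Box \<phi>) \<longleftrightarrow> (\<forall>v\<in>W. (w, v) \<in> R \<longrightarrow> holds W R V v \<phi>)"

definition logic_of :: "('w set \<Rightarrow> ('w \<times> 'w) set \<Rightarrow> bool) \<Rightarrow> 'a fm set" where
  "logic_of C = {\<phi>. \<forall>W R V w. frame W R \<longrightarrow> C W R \<longrightarrow> w \<in> W \<longrightarrow> holds W R V w \<phi>}"

definition EQ_cond :: "nat \<Rightarrow> 'w set \<Rightarrow> ('w \<times> 'w) set \<Rightarrow> bool" where
  "EQ_cond n W R \<longleftrightarrow> equiv W R \<and> finite W \<and> card W \<le> n"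

definition no_infinite_chain :: "('w \<times> 'w) set \<Rightarrow> bool" where
  "no_infinite_chain R \<longleftrightarrow> \<not> (\<exists>f :: nat \<Rightarrow> 'w. \<forall>i. (f i, f (Suc i)) \<in> R)"

text \<open>The length of a chain is the number of worlds on it, so the linear
  frame consisting of a single irreflexive world has length 1.\<close>

definition length_at_most :: "nat \<Rightarrow> 'w set \<Rightarrow> ('w \<times> 'w) set \<Rightarrow> bool" where
  "length_at_most n W R \<longleftrightarrow>
     (\<forall>ws. set ws \<subseteq> W \<and> successively (\<lambda>w v. (w, v) \<in> R) ws \<longrightarrow> length ws \<le> n)"

definition LO_cond :: "nat \<Rightarrow> 'w set \<Rightarrow> ('w \<times> 'w) set \<Rightarrow> bool" where
  "LO_cond n W R \<longleftrightarrow>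
     trans R \<and> no_infinite_chain R \<and>
     (\<forall>w\<in>W. \<forall>v\<in>W. (w, v) \<in> R \<or> (v, w) \<in> R \<or> w = v) \<and>
     length_at_most n W R"

text \<open>All frames satisfying \<open>EQ_cond n\<close> or \<open>LO_cond n\<close> are finite, so frames whose worlds
  are natural numbers represent all of them up to isomorphism. The lemmas \<open>EQ_all_frames\<close> and
  \<open>LO_all_frames\<close> below show that worlds of any other type do not make the logics smaller.\<close>

definition EQ :: "nat \<Rightarrow> 'a fm set" where
  "EQ n = logic_of (EQ_cond n :: nat set \<Rightarrow> (nat \<times> nat) set \<Rightarrow> bool)"

definition LO :: "nat \<Rightarrow> 'a fm set" where
  "LO n = logic_of (LO_cond n :: nat set \<Rightarrow> (nat \<times> nat) set \<Rightarrow> bool)"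

definition craig_interpolation :: "'a fm set \<Rightarrow> bool" where
  "craig_interpolation L \<longleftrightarrow>
     (\<forall>\<phi> \<psi>. Imp \<phi> \<psi> \<in> L \<longrightarrow>
        (\<exists>\<chi>. Imp \<phi> \<chi> \<in> L \<and> Imp \<chi> \<psi> \<in> L \<and> sig \<chi> \<subseteq> sig \<phi> \<inter> sig \<psi>))"

definition uniform_interpolation :: "'a fm set \<Rightarrow> bool" where
  "uniform_interpolation L \<longleftrightarrow>
     (\<forall>\<phi> \<sigma>. \<exists>\<chi>. sig \<chi> \<subseteq> \<sigma> \<and> Imp \<phi> \<chi> \<in> L \<and>
        (\<forall>\<psi>. sig \<psi> \<inter> sig \<phi> \<subseteq> \<sigma> \<and> Imp \<phi> \<psi> \<in> L \<longrightarrow> Imp \<chi> \<psi> \<in> L))"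

lemma holds_image:
  assumes "inj_on f W" "R \<subseteq> W \<times> W" "w \<in> W"
  shows "holds (f ` W) (map_prod f f ` R) (V \<circ> inv_into W f) (f w) \<phi> \<longleftrightarrow> holds W R V w \<phi>"
  using assms(3)
proof (induction \<phi> arbitrary: w)
  case (Box \<phi>)
  have "(f w, f v) \<in> map_prod f f ` R \<longleftrightarrow> (w, v) \<in> R" if "v \<in> W" for v
  proof
    assume "(f w, f v) \<in> map_prod f f ` R"
    then obtain a b where ab: "(a, b) \<in> R" "f w = f a" "f v = f b"
      by auto
    then have "w = a" "v = b"
      using inj_onD[OF assms(1)] assms(2) Box.prems that by blast+
    then show "(w, v) \<in> R"
      using ab(1) by simp
  qed (rule map_prod_imageI)
  then show ?case
    using Box by simp
qed (use assms(1) in simp_all)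

lemma logic_of_transfer:
  fixes C :: "'w set \<Rightarrow> ('w \<times> 'w) set \<Rightarrow> bool" and D :: "nat set \<Rightarrow> (nat \<times> nat) set \<Rightarrow> bool"
  assumes fin: "\<And>W R. frame W R \<Longrightarrow> C W R \<Longrightarrow> finite W"
    and img: "\<And>W R f. frame W R \<Longrightarrow> C W R \<Longrightarrow> inj_on f W \<Longrightarrow> D (f ` W) (map_prod f f ` R)"
  shows "logic_of D \<subseteq> logic_of C"
proof
  fix \<phi> :: "'a fm" assume \<phi>: "\<phi> \<in> logic_of D"
  have "holds W R V w \<phi>" if fr: "frame W R" and C: "C W R" and w: "w \<in> W"
    for W :: "'w set" and R V w
  proof -
    obtain f :: "'w \<Rightarrow> nat" where f: "inj_on f W"
      using finite_imp_inj_to_nat_seg[OF fin[OF fr C]] by blast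
    have "frame (f ` W) (map_prod f f ` R)"
      using fr by (auto simp: frame_def)
    then have "holds (f ` W) (map_prod f f ` R) (V \<circ> inv_into W f) (f w) \<phi>"
      using \<phi> img[OF fr C f] w unfolding logic_of_def by blast
    then show ?thesis
      using holds_image[OF f _ w] fr by (auto simp: frame_def)
  qed
  then show "\<phi> \<in> logic_of C"
    by (auto simp: logic_of_def)
qed

lemma EQ_all_frames: "EQ n \<subseteq> logic_of (EQ_cond n :: 'w set \<Rightarrow> ('w \<times> 'w) set \<Rightarrow> bool)"
  unfolding EQ_def
proof (rule logic_of_transfer)
  fix W :: "'w set" and R and f :: "'w \<Rightarrow> nat"
  assume C: "EQ_cond n W R" and f: "inj_on f W"
  then have R: "R \<subseteq> W \<times> W" "refl_on W R" "sym R" "trans R"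
    by (auto simp: EQ_cond_def equiv_def)
  have "trans (map_prod f f ` R)"
  proof (rule transI)
    fix x y z assume "(x, y) \<in> map_prod f f ` R" "(y, z) \<in> map_prod f f ` R"
    then obtain a b b' c where *: "(a, b) \<in> R" "(b', c) \<in> R" "f b = f b'" "x = f a" "z = f c"
      by auto
    then have "b = b'"
      using R(1) f by (auto simp: inj_on_def)
    then show "(x, z) \<in> map_prod f f ` R"
      using * R(4) by (auto dest: transD)
  qed
  moreover have "sym (map_prod f f ` R)"
    using R(3) by (auto simp: sym_def)
  moreover have "refl_on (f ` W) (map_prod f f ` R)"
    using R(2) by (auto simp: refl_on_def)
  ultimately have "equiv (f ` W) (map_prod f f ` R)"
    using R(1) by (auto simp: equiv_def)
  then show "EQ_cond n (f ` W) (map_prod f f ` R)"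
    using C f by (simp add: EQ_cond_def card_image)
qed (simp add: EQ_cond_def)

lemma LO_cond_finite:
  assumes "LO_cond n W R"
  shows "finite W"
proof (rule ccontr)
  assume "infinite W"
  then obtain S where S: "S \<subseteq> W" "finite S" "card S = Suc n"
    using infinite_arbitrarily_large by blast
  have "\<exists>ws. sorted_wrt (\<lambda>w v. (w, v) \<in> R) ws \<and> set ws = S"
    using S(2,1)
  proof (induction S)
    case (insert a S)
    then obtain ws where ws: "sorted_wrt (\<lambda>w v. (w, v) \<in> R) ws" "set ws = S"
      by auto
    let ?vs = "filter (\<lambda>w. (w, a) \<in> R) ws @ a # filter (\<lambda>w. (a, w) \<in> R) ws"
    have "sorted_wrt (\<lambda>w v. (w, v) \<in> R) ?vs"
      using ws(1) assms by (auto simp: sorted_wrt_append sorted_wrt_filter LO_cond_def dest: transD)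
    moreover have "(w, a) \<in> R \<or> (a, w) \<in> R" if "w \<in> S" for w
      using assms insert.hyps insert.prems that unfolding LO_cond_def by blast
    then have "set ?vs = insert a S"
      using ws(2) by auto
    ultimately show ?case by blast
  qed simp
  then obtain ws where ws: "sorted_wrt (\<lambda>w v. (w, v) \<in> R) ws" "set ws = S"
    by blast
  have "successively (\<lambda>w v. (w, v) \<in> R) ws"
    using ws(1) by (simp add: successively_if_sorted_wrt)
  then have "length ws \<le> n"
    using assms ws(2) S(1) by (auto simp: LO_cond_def length_at_most_def)
  then show False
    using card_length[of ws] ws(2) S(3) by simp
qed

lemma LO_all_frames: "LO n \<subseteq> logic_of (LO_cond n :: 'w set \<Rightarrow> ('w \<times> 'w) set \<Rightarrow> bool)"
  unfolding LO_def
proof (rule logic_of_transfer)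
  fix W :: "'w set" and R and f :: "'w \<Rightarrow> nat"
  assume fr: "frame W R" and C: "LO_cond n W R" and f: "inj_on f W"
  let ?R = "map_prod f f ` R" and ?g = "inv_into W f"
  have R: "R \<subseteq> W \<times> W"
    using fr by (simp add: frame_def)
  have pull: "(?g x, ?g y) \<in> R" if "(x, y) \<in> ?R" for x y
    using that R f by auto
  have trans: "trans ?R"
  proof (rule transI)
    fix x y z assume xyz: "(x, y) \<in> ?R" "(y, z) \<in> ?R"
    then have "(?g x, ?g z) \<in> R"
      using pull C unfolding LO_cond_def by (meson transD)
    then have "(f (?g x), f (?g z)) \<in> ?R"
      by (rule map_prod_imageI)
    moreover have "x \<in> f ` W" "z \<in> f ` W"
      using xyz R by auto
    ultimately show "(x, z) \<in> ?R"
      by (simp add: f_inv_into_f)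
  qed
  have "no_infinite_chain ?R"
    unfolding no_infinite_chain_def
  proof
    assume "\<exists>h. \<forall>i. (h i, h (Suc i)) \<in> ?R"
    then obtain h where "\<forall>i. (h i, h (Suc i)) \<in> ?R" ..
    then have "\<forall>i. ((?g \<circ> h) i, (?g \<circ> h) (Suc i)) \<in> R"
      using pull by simp
    then show False
      using C unfolding LO_cond_def no_infinite_chain_def by blast
  qed
  moreover have "(x, y) \<in> ?R \<or> (y, x) \<in> ?R \<or> x = y" if "x \<in> f ` W" "y \<in> f ` W" for x y
    using that C unfolding LO_cond_def by blast
  moreover have "length_at_most n (f ` W) ?R"
    unfolding length_at_most_def
  proof (intro allI impI, elim conjE)
    fix ws assume ws: "set ws \<subseteq> f ` W" "successively (\<lambda>x y. (x, y) \<in> ?R) ws"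
    have "successively (\<lambda>w v. (w, v) \<in> R) (map ?g ws)"
      unfolding successively_map by (rule successively_mono[OF ws(2)]) (rule pull)
    moreover have "set (map ?g ws) \<subseteq> W"
      using ws(1) by (auto intro: inv_into_into)
    ultimately have "length (map ?g ws) \<le> n"
      using C unfolding LO_cond_def length_at_most_def by blast
    then show "length ws \<le> n" by simp
  qed
  ultimately show "LO_cond n (f ` W) ?R"
    using trans by (simp add: LO_cond_def)
qed (rule LO_cond_finite)

end

(* In EQ_1, EQ_2 and LO_n, the submodel generated by a world is the bounded-morphic image of a
   model on one of finitely many canonical pointed frames, on which the formulas over a signature
   tau that hold at the root determine the frame and the tau-part of the valuation at every world.
   A uniform interpolant of phi over tau then describes the tau-parts of canonical models of phi,
   and two canonical models with the same tau-part are amalgamated on their common frame. For EQ_n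
   with n >= 3, having n - 1 worlds with r excludes having two worlds without r, but formulas over
   r alone cannot count worlds. *)

theory Submission
  imports Defs
begin

section \<open>Coincidence, bounded morphisms and definability\<close>

primrec Conjs :: "'a fm list \<Rightarrow> 'a fm" where
  "Conjs [] = Truth"
| "Conjs (\<phi> # \<phi>s) = Conj \<phi> (Conjs \<phi>s)"

lemma holds_Conjs [simp]: "holds W R V w (Conjs \<phi>s) \<longleftrightarrow> (\<forall>\<phi>\<in>set \<phi>s. holds W R V w \<phi>)"
  by (induction \<phi>s) auto

lemma sig_Conjs [simp]: "sig (Conjs \<phi>s) = (\<Union>\<phi>\<in>set \<phi>s. sig \<phi>)"
  by (induction \<phi>s) auto

abbreviation Dia :: "'a fm \<Rightarrow> 'a fm" where
  "Dia \<phi> \<equiv> Neg (Box (Neg \<phi>))"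

lemma holds_coincidence:
  assumes "\<And>v. v \<in> W \<Longrightarrow> V v \<inter> sig \<phi> = U v \<inter> sig \<phi>" and "w \<in> W"
  shows "holds W R V w \<phi> \<longleftrightarrow> holds W R U w \<phi>"
  using assms
proof (induction \<phi> arbitrary: w)
  case (Conj \<phi> \<psi>)
  have "V v \<inter> sig \<phi> = U v \<inter> sig \<phi>" "V v \<inter> sig \<psi> = U v \<inter> sig \<psi>" if "v \<in> W" for v
    using Conj.prems(1)[OF that] by auto
  then show ?case using Conj.IH Conj.prems(2) by simp
qed auto

text \<open>Forth and back clauses only: valuations are pulled back by composition with
  \<open>f\<close>, and the image may be just the part of the frame generated by one world.\<close>

definition bounded_morphism ::
    "'v set \<Rightarrow> ('v \<times> 'v) set \<Rightarrow> 'w set \<Rightarrow> ('w \<times> 'w) set \<Rightarrow> ('v \<Rightarrow> 'w) \<Rightarrow> bool" where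
  "bounded_morphism W' R' W R f \<longleftrightarrow>
     f ` W' \<subseteq> W \<and>
     (\<forall>a\<in>W'. \<forall>b\<in>W'. (a, b) \<in> R' \<longrightarrow> (f a, f b) \<in> R) \<and>
     (\<forall>a\<in>W'. \<forall>v\<in>W. (f a, v) \<in> R \<longrightarrow> (\<exists>b\<in>W'. (a, b) \<in> R' \<and> f b = v))"

lemma holds_bounded_morphism:
  assumes f: "bounded_morphism W' R' W R f" and "a \<in> W'"
  shows "holds W' R' (V \<circ> f) a \<phi> \<longleftrightarrow> holds W R V (f a) \<phi>"
  using assms(2)
proof (induction \<phi> arbitrary: a)
  case (Box \<phi>)
  have zig: "\<exists>b\<in>W'. (a, b) \<in> R' \<and> f b = v" if "v \<in> W" "(f a, v) \<in> R" for v
    using f Box.prems that by (simp add: bounded_morphism_def)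
  have zag: "f b \<in> W \<and> ((a, b) \<in> R' \<longrightarrow> (f a, f b) \<in> R)" if "b \<in> W'" for b
    using f Box.prems that by (simp add: bounded_morphism_def image_subset_iff)
  have "holds W' R' (V \<circ> f) a (Box \<phi>) \<longleftrightarrow> (\<forall>b\<in>W'. (a, b) \<in> R' \<longrightarrow> holds W R V (f b) \<phi>)"
    unfolding holds.simps using Box.IH by blast
  also have "\<dots> \<longleftrightarrow> holds W R V (f a) (Box \<phi>)"
    using zig zag by (simp, metis)
  finally show ?case .
qed simp_all

text \<open>Each \<open>x\<close> has a characteristic formula \<open>\<delta> x\<close>, the
  conjunction of formulas telling it from the other members of \<open>T\<close>; the disjunction of
  these over \<open>S\<close> defines \<open>S\<close>. An abstract \<open>sat\<close> allows the
  points to be codes of models on different frames.\<close>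

lemma definable_if_separated:
  fixes sat :: "'x \<Rightarrow> 'a fm \<Rightarrow> bool"
  assumes T: "finite T" "S \<subseteq> T"
    and sat_Truth: "\<And>x. sat x Truth"
    and sat_Neg: "\<And>x \<phi>. sat x (Neg \<phi>) \<longleftrightarrow> \<not> sat x \<phi>"
    and sat_Conj: "\<And>x \<phi> \<psi>. sat x (Conj \<phi> \<psi>) \<longleftrightarrow> sat x \<phi> \<and> sat x \<psi>"
    and sep: "\<And>x y. x \<in> T \<Longrightarrow> y \<in> T \<Longrightarrow> x \<noteq> y \<Longrightarrow> \<exists>\<phi>. sig \<phi> \<subseteq> \<tau> \<and> sat x \<phi> \<noteq> sat y \<phi>"
  shows "\<exists>\<chi>. sig \<chi> \<subseteq> \<tau> \<and> (\<forall>x\<in>T. sat x \<chi> \<longleftrightarrow> x \<in> S)"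
proof -
  have sat_Conjs: "sat x (Conjs \<phi>s) \<longleftrightarrow> (\<forall>\<phi>\<in>set \<phi>s. sat x \<phi>)" for x \<phi>s
    by (induction \<phi>s) (auto simp: sat_Truth sat_Conj)
  \<comment> \<open>Negation orients a separating formula so that it holds at
    \<open>x\<close>.\<close>
  have "\<exists>\<phi>. sig \<phi> \<subseteq> \<tau> \<and> sat x \<phi> \<and> \<not> sat y \<phi>" if xy: "x \<in> T" "y \<in> T" "x \<noteq> y" for x y
  proof -
    obtain \<phi> where \<phi>: "sig \<phi> \<subseteq> \<tau>" "sat x \<phi> \<noteq> sat y \<phi>"
      using sep[OF xy] by blast
    then show ?thesis
      using exI[of _ \<phi>] exI[of _ "Neg \<phi>"] sat_Neg by (metis fm.set(3))
  qed
  then have "\<forall>x y. \<exists>\<phi>. x \<in> T \<longrightarrow> y \<in> T \<longrightarrow> x \<noteq> y \<longrightarrow> sig \<phi> \<subseteq> \<tau> \<and> sat x \<phi> \<and> \<not> sat y \<phi>"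
    by blast
  then obtain \<theta> where \<theta>: "\<And>x y. x \<in> T \<Longrightarrow> y \<in> T \<Longrightarrow> x \<noteq> y \<Longrightarrow>
      sig (\<theta> x y) \<subseteq> \<tau> \<and> sat x (\<theta> x y) \<and> \<not> sat y (\<theta> x y)"
    unfolding choice_iff by blast
  obtain ts where ts: "set ts = T"
    using finite_list[OF T(1)] by blast
  obtain ss where ss: "set ss = S"
    using finite_list[OF finite_subset[OF T(2,1)]] by blast
  define \<delta> where "\<delta> x = Conjs (map (\<theta> x) (filter (\<lambda>y. y \<noteq> x) ts))" for x
  have sat_\<delta>: "sat y (\<delta> x) \<longleftrightarrow> y = x" if "x \<in> T" "y \<in> T" for x y
    using \<theta> that ts by (auto simp: \<delta>_def sat_Conjs)
  have sig_\<delta>: "sig (\<delta> x) \<subseteq> \<tau>" if "x \<in> T" for x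
    using \<theta>[OF that] ts by (fastforce simp: \<delta>_def)
  show ?thesis
  proof (intro exI conjI ballI)
    \<comment> \<open>A disjunction of the \<open>\<delta> x\<close>, expressed through De
      Morgan.\<close>
    show "sig (Neg (Conjs (map (\<lambda>x. Neg (\<delta> x)) ss))) \<subseteq> \<tau>"
      using sig_\<delta> ss T(2) by auto
    show "sat y (Neg (Conjs (map (\<lambda>x. Neg (\<delta> x)) ss))) \<longleftrightarrow> y \<in> S" if "y \<in> T" for y
      using sat_\<delta>[OF _ that] ss T(2) by (auto simp: sat_Neg sat_Conjs)
  qed
qed

text \<open>\<open>canon\<close> and \<open>repr\<close> reduce validity to roots of canonical
  frames; \<open>sep\<close> makes every set of \<open>\<tau>\<close>-reducts definable. The index
  \<open>k\<close> is also the number of worlds, so a list of valuations determines its frame by its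
  length.\<close>

lemma uniform_interpolation_if_canonical:
  fixes C :: "nat set \<Rightarrow> (nat \<times> nat) set \<Rightarrow> bool" and Rel :: "nat \<Rightarrow> (nat \<times> nat) set"
  assumes K: "finite K"
    and canon: "\<And>k. k \<in> K \<Longrightarrow> frame {..<k} (Rel k) \<and> C {..<k} (Rel k)"
    and repr: "\<And>W R w. frame W R \<Longrightarrow> C W R \<Longrightarrow> w \<in> W \<Longrightarrow>
      \<exists>k\<in>K. \<exists>f. f 0 = w \<and> bounded_morphism {..<k} (Rel k) W R f"
    and sep: "\<And>k k' V V' \<tau>. k \<in> K \<Longrightarrow> k' \<in> K \<Longrightarrow>
      (\<And>\<theta> :: 'a fm. sig \<theta> \<subseteq> \<tau> \<Longrightarrow>
        holds {..<k} (Rel k) V 0 \<theta> \<longleftrightarrow> holds {..<k'} (Rel k') V' 0 \<theta>) \<Longrightarrow>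
      k = k' \<and> (\<forall>i<k. V i \<inter> \<tau> = V' i \<inter> \<tau>)"
  shows "uniform_interpolation (logic_of C :: 'a fm set)"
  unfolding uniform_interpolation_def
proof (intro allI)
  fix \<phi> :: "'a fm" and \<sigma> :: "'a set"
  \<comment> \<open>Intersecting with \<open>sig \<phi>\<close> gives a finite signature even for
    infinite \<open>\<sigma>\<close>.\<close>
  define \<tau> where "\<tau> = sig \<phi> \<inter> \<sigma>"
  have "finite (sig \<phi>)" by (induction \<phi>) auto
  then have fin_\<tau>: "finite \<tau>" by (simp add: \<tau>_def)
  have pos: "0 < k" if "k \<in> K" for k
    using canon[OF that] by (auto simp: frame_def)
  define sat :: "nat \<Rightarrow> (nat \<Rightarrow> 'a set) \<Rightarrow> 'a fm \<Rightarrow> bool"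
    where "sat k V = holds {..<k} (Rel k) V 0" for k V
  have sat_cong: "sat k V \<theta> \<longleftrightarrow> sat k U \<theta>"
    if "k \<in> K" "\<And>i. i < k \<Longrightarrow> V i \<inter> sig \<theta> = U i \<inter> sig \<theta>" for k V U \<theta>
    unfolding sat_def by (rule holds_coincidence) (use that pos in auto)
  \<comment> \<open>Codes of all canonical models up to their \<open>\<tau>\<close>-part: finitely
    many, since \<open>K\<close> and \<open>\<tau>\<close> are finite.\<close>
  define T where "T = (\<Union>k\<in>K. {t. set t \<subseteq> Pow \<tau> \<and> length t = k})"
  define restr :: "nat \<Rightarrow> (nat \<Rightarrow> 'a set) \<Rightarrow> 'a set list"
    where "restr k V = map (\<lambda>i. V i \<inter> \<tau>) [0..<k]" for k V
  define S where "S = {restr k V |k V. k \<in> K \<and> sat k V \<phi>}"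
  have restr_T: "restr k V \<in> T" if "k \<in> K" for k V
    using that by (auto simp: restr_def T_def)
  \<comment> \<open>Values of \<open>nth\<close> past the end of the list are harmless, as only
    worlds below \<open>k\<close> are evaluated.\<close>
  have sat_restr: "sat k (nth (restr k V)) \<theta> \<longleftrightarrow> sat k V \<theta>" if "k \<in> K" "sig \<theta> \<subseteq> \<tau>" for k V \<theta>
    by (rule sat_cong) (use that in \<open>auto simp: restr_def\<close>)
  have "\<exists>\<chi>. sig \<chi> \<subseteq> \<tau> \<and> (\<forall>t\<in>T. sat (length t) (nth t) \<chi> \<longleftrightarrow> t \<in> S)"
  proof (rule definable_if_separated)
    show "finite T"
      unfolding T_def using K fin_\<tau> by (intro finite_UN_I finite_lists_length_eq) auto
    show "S \<subseteq> T"
      using restr_T by (auto simp: S_def)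
    fix t u assume tu: "t \<in> T" "u \<in> T" "t \<noteq> u"
    show "\<exists>\<theta>. sig \<theta> \<subseteq> \<tau> \<and> sat (length t) (nth t) \<theta> \<noteq> sat (length u) (nth u) \<theta>"
    proof (rule ccontr)
      assume "\<not> ?thesis"
      then have "length t = length u \<and> (\<forall>i<length t. t ! i \<inter> \<tau> = u ! i \<inter> \<tau>)"
        using tu by (intro sep) (auto simp: T_def sat_def)
      moreover have "t ! i \<inter> \<tau> = t ! i" if "i < length t" for i
        using nth_mem[OF that] tu(1) by (auto simp: T_def)
      moreover have "u ! i \<inter> \<tau> = u ! i" if "i < length u" for i
        using nth_mem[OF that] tu(2) by (auto simp: T_def)
      ultimately have "t = u"
        by (metis nth_equalityI)
      then show False using tu by simp
    qed
  qed (simp_all add: sat_def)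
  then obtain \<chi> where \<chi>: "sig \<chi> \<subseteq> \<tau>" "\<And>t. t \<in> T \<Longrightarrow> sat (length t) (nth t) \<chi> \<longleftrightarrow> t \<in> S"
    by blast
  have sat_\<chi>: "sat k V \<chi> \<longleftrightarrow> restr k V \<in> S" if "k \<in> K" for k V
    using \<chi>(2)[OF restr_T[OF that, of V]] sat_restr[OF that \<chi>(1), of V] by (simp add: restr_def)
  \<comment> \<open>Any pointed model is reached by pulling its valuation back along the bounded
    morphism from \<open>repr\<close>.\<close>
  have logicI: "\<theta> \<in> logic_of C" if "\<And>k V. k \<in> K \<Longrightarrow> sat k V \<theta>" for \<theta>
    unfolding logic_of_def
  proof (intro CollectI allI impI)
    fix W R w and V :: "nat \<Rightarrow> 'a set"
    assume "frame W R" "C W R" "w \<in> W"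
    then obtain k f where kf: "k \<in> K" "f 0 = w" "bounded_morphism {..<k} (Rel k) W R f"
      using repr by blast
    then show "holds W R V w \<theta>"
      using that[OF kf(1), of "V \<circ> f"] holds_bounded_morphism[OF kf(3)] pos by (auto simp: sat_def)
  qed
  have logicD: "sat k V \<theta>" if "\<theta> \<in> logic_of C" "k \<in> K" for k V \<theta>
    using that canon[OF that(2)] pos unfolding logic_of_def sat_def by simp
  have "Imp \<phi> \<chi> \<in> logic_of C"
    by (rule logicI) (use sat_\<chi> in \<open>auto simp: sat_def S_def\<close>)
  moreover have "Imp \<chi> \<psi> \<in> logic_of C"
    if \<psi>: "sig \<psi> \<inter> sig \<phi> \<subseteq> \<sigma>" "Imp \<phi> \<psi> \<in> logic_of C" for \<psi>
  proof (rule logicI)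
    fix k V assume k: "k \<in> K"
    have "sat k V \<psi>" if "sat k V \<chi>"
    proof -
      have "restr k V \<in> S"
        using that sat_\<chi>[OF k, of V] by simp
      then obtain k' V' where V': "restr k V = restr k' V'" "sat k' V' \<phi>"
        unfolding S_def by blast
      have "length (restr k V) = length (restr k' V')" using V'(1) by simp
      then have [simp]: "k' = k" by (simp add: restr_def)
      have eq: "V i \<inter> \<tau> = V' i \<inter> \<tau>" if "i < k" for i
        using V'(1) that by (simp add: restr_def)
      \<comment> \<open>The amalgam: atoms of \<open>\<phi>\<close> come from \<open>V'\<close>, all
        others from \<open>V\<close>. It agrees with \<open>V\<close> on \<open>sig \<psi>\<close>,
        because atoms shared with \<open>\<phi>\<close> lie in \<open>\<tau>\<close>, where
        \<open>V\<close> and \<open>V'\<close> coincide.\<close>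
      define U where "U i = (V' i \<inter> sig \<phi>) \<union> (V i - sig \<phi>)" for i
      have "sat k U \<phi>"
        using V'(2) sat_cong[OF k, of U \<phi> V'] by (auto simp: U_def)
      then have "sat k U \<psi>"
        using logicD[OF \<psi>(2) k] by (simp add: sat_def)
      moreover have "U i \<inter> sig \<psi> = V i \<inter> sig \<psi>" if "i < k" for i
        using eq[OF that] \<psi>(1) by (auto simp: U_def \<tau>_def)
      ultimately show ?thesis
        using sat_cong[OF k] by blast
    qed
    then show "sat k V (Imp \<chi> \<psi>)" by (auto simp: sat_def)
  qed
  ultimately show "\<exists>\<chi>. sig \<chi> \<subseteq> \<sigma> \<and> Imp \<phi> \<chi> \<in> logic_of C \<and>
      (\<forall>\<psi>. sig \<psi> \<inter> sig \<phi> \<subseteq> \<sigma> \<and> Imp \<phi> \<psi> \<in> logic_of C \<longrightarrow> Imp \<chi> \<psi> \<in> logic_of C)"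
    using \<chi>(1) by (auto simp: \<tau>_def)
qed

section \<open>Equivalence relations\<close>

abbreviation full :: "nat \<Rightarrow> (nat \<times> nat) set" where
  "full k \<equiv> {..<k} \<times> {..<k}"

lemma frame_full: "0 < k \<Longrightarrow> frame {..<k} (full k)"
  by (auto simp: frame_def)

lemma EQ_cond_full: "k \<le> n \<Longrightarrow> EQ_cond n {..<k} (full k)"
  by (auto simp: EQ_cond_def equiv_def refl_on_def sym_def trans_def)

text \<open>Every map from the full relation onto the equivalence class of \<open>w\<close> is a
  bounded morphism, and the class has at most \<open>m\<close> worlds.\<close>

lemma EQ_cond_bounded_morphism:
  assumes C: "EQ_cond m W R" and w: "w \<in> W"
  shows "\<exists>f. f 0 = w \<and> bounded_morphism {..<m} (full m) W R f"
proof -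
  have R: "R \<subseteq> W \<times> W" "refl_on W R" "sym R" "trans R" and fin: "finite W" and m: "card W \<le> m"
    using C by (auto simp: EQ_cond_def equiv_def)
  let ?A = "R `` {w} - {w}"
  have sub: "?A \<subseteq> W - {w}" using R(1) by auto
  then have finA: "finite ?A"
    using fin finite_subset by blast
  have "card ?A \<le> card W - 1"
    using fin w card_mono[OF _ sub] by simp
  then have "card ?A < m"
    using m w fin by (metis card_gt_0_iff diff_less empty_iff le_less_trans less_le_trans less_one)
  moreover obtain xs where xs: "set xs = ?A" "length xs = card ?A"
    using finite_distinct_list[OF finA] distinct_card by metis
  ultimately have len: "length xs < m" by simp
  \<comment> \<open>The default \<open>w\<close> duplicates the root on leftover indices, so the
    single frame with exactly \<open>m\<close> worlds covers all class sizes.\<close>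
  define f where "f i = (if i < length (w # xs) then (w # xs) ! i else w)" for i
  have cls: "R `` {w} = set (w # xs)"
    using xs(1) R(2) w by (auto simp: refl_on_def)
  have in_cls: "(w, f i) \<in> R" for i
  proof -
    have "f i \<in> set (w # xs)" using nth_mem[of i "w # xs"] by (cases "i < length (w # xs)") (auto simp: f_def)
    then show ?thesis using cls by blast
  qed
  have onto: "\<exists>i<m. f i = v" if "(w, v) \<in> R" for v
  proof -
    have "v \<in> set (w # xs)" using that cls by blast
    then obtain i where "i < length (w # xs)" "(w # xs) ! i = v"
      unfolding in_set_conv_nth by blast
    then show ?thesis using len by (intro exI[of _ i]) (auto simp: f_def)
  qed
  have "(f i, f j) \<in> R" for i j
    using in_cls[of i] in_cls[of j] R(3,4) by (meson symD transD)
  moreover have "f i \<in> W" for i using in_cls R(1) by auto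
  moreover have "\<exists>i<m. f i = v" if "(f a, v) \<in> R" for a v
    using onto transD[OF R(4) in_cls that] .
  ultimately have "bounded_morphism {..<m} (full m) W R f"
    by (auto simp: bounded_morphism_def Bex_def)
  moreover have "f 0 = w" by (simp add: f_def)
  ultimately show ?thesis by blast
qed

text \<open>Separation succeeds because at most one world differs from the root; two or more such
  worlds could be permuted without changing any formula at the root.\<close>

lemma uniform_interpolation_EQ:
  assumes m: "m = 1 \<or> m = 2"
  shows "uniform_interpolation (EQ m :: 'a fm set)"
  unfolding EQ_def
proof (rule uniform_interpolation_if_canonical[where K = "{m}" and Rel = full])
  show "frame {..<k} (full k) \<and> EQ_cond m {..<k} (full k)" if "k \<in> {m}" for k
    using m that frame_full[of k] EQ_cond_full[of k m] by auto
  show "\<exists>k\<in>{m}. \<exists>f. f 0 = w \<and> bounded_morphism {..<k} (full k) W R f"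
    if "EQ_cond m W R" "w \<in> W" for W R and w :: nat
    using EQ_cond_bounded_morphism[OF that] by simp
next
  fix k k' :: nat and V V' :: "nat \<Rightarrow> 'a set" and \<tau> :: "'a set"
  assume "k \<in> {m}" "k' \<in> {m}"
    and "\<And>\<theta> :: 'a fm. sig \<theta> \<subseteq> \<tau> \<Longrightarrow>
      holds {..<k} (full k) V 0 \<theta> \<longleftrightarrow> holds {..<k'} (full k') V' 0 \<theta>"
  then have k: "k = m" "k' = m" and
    eq: "\<And>\<theta> :: 'a fm. sig \<theta> \<subseteq> \<tau> \<Longrightarrow>
      holds {..<m} (full m) V 0 \<theta> \<longleftrightarrow> holds {..<m} (full m) V' 0 \<theta>"
    by auto
  have 0: "p \<in> V 0 \<longleftrightarrow> p \<in> V' 0" if "p \<in> \<tau>" for p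
    using eq[of "Atom p"] that by simp
  \<comment> \<open>With the value of \<open>p\<close> at world 0 known, one of the two boxed
    formulas reveals its value at world 1.\<close>
  have 1: "p \<in> V 1 \<longleftrightarrow> p \<in> V' 1" if "p \<in> \<tau>" "m = 2" for p
    using eq[of "Box (Atom p)"] eq[of "Box (Neg (Atom p))"] 0[OF that(1)] that
    by (auto simp: less_2_cases_iff)
  show "k = k' \<and> (\<forall>i<k. V i \<inter> \<tau> = V' i \<inter> \<tau>)"
    using k m 0 1 by (auto simp: less_2_cases_iff)
qed simp

text \<open>One model of \<open>\<phi>\<close> has \<open>n - 1\<close> worlds with \<open>r\<close>
  and one without; a model refuting \<open>\<psi>\<close> has one with \<open>r\<close> and two
  without. Both map onto the same two-world model over \<open>r\<close>, so no interpolant tells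
  them apart. The infinite supply of atoms provides \<open>r\<close>, \<open>q\<close> and the
  \<open>p i\<close> for every \<open>n\<close>.\<close>

lemma not_craig_interpolation_EQ:
  assumes inf: "infinite (UNIV :: 'a set)" and n: "3 \<le> n"
  shows "\<not> craig_interpolation (EQ n :: 'a fm set)"
proof
  assume craig: "craig_interpolation (EQ n :: 'a fm set)"
  obtain e :: "nat \<Rightarrow> 'a" where e: "inj e"
    using infinite_countable_subset[OF inf] by blast
  define r q p where "r = e 0" and "q = e 1" and "p i = e (i + 2)" for i
  have atoms: "r \<noteq> q" "q \<noteq> r" "p i \<noteq> r" "p i \<noteq> q" "r \<noteq> p i" "q \<noteq> p i" "p i = p j \<longleftrightarrow> i = j" for i j
    using e by (auto simp: r_def q_def p_def inj_eq)
  \<comment> \<open>Negating the earlier \<open>p j\<close> makes the \<open>\<alpha> i\<close>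
    pairwise incompatible, so their witnesses are distinct worlds.\<close>
  define \<alpha> where "\<alpha> i = Conj (Atom r) (Conj (Atom (p i)) (Conjs (map (\<lambda>j. Neg (Atom (p j))) [0..<i])))" for i
  define \<phi> where "\<phi> = Conjs (map (\<lambda>i. Dia (\<alpha> i)) [0..<n - 1])"
  \<comment> \<open>The atom \<open>q\<close> serves to tell apart two worlds without
    \<open>r\<close>.\<close>
  define \<psi> where "\<psi> = Neg (Conj (Dia (Conj (Neg (Atom r)) (Atom q))) (Dia (Conj (Neg (Atom r)) (Neg (Atom q)))))"
  have "Imp \<phi> \<psi> \<in> EQ n"
    unfolding EQ_def logic_of_def
  proof (intro CollectI allI impI)
    fix W :: "nat set" and R w and V :: "nat \<Rightarrow> 'a set"
    assume C: "EQ_cond n W R"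
    have False if \<phi>: "holds W R V w \<phi>" and \<psi>: "\<not> holds W R V w \<psi>"
    proof -
      have "\<exists>v\<in>W. holds W R V v (\<alpha> i)" if "i < n - 1" for i
        using \<phi> that by (auto simp: \<phi>_def)
      then obtain g where g: "\<And>i. i < n - 1 \<Longrightarrow> g i \<in> W" "\<And>i. i < n - 1 \<Longrightarrow> holds W R V (g i) (\<alpha> i)"
        by metis
      obtain x y where xy: "x \<in> W" "y \<in> W" "r \<notin> V x" "r \<notin> V y" "q \<in> V x" "q \<notin> V y"
        using \<psi> by (auto simp: \<psi>_def)
      have "g i \<noteq> g j" if "i < j" "j < n - 1" for i j
        using g(2)[of i] g(2)[of j] that by (auto simp: \<alpha>_def)
      then have "inj_on g {..<n - 1}"
        by (metis inj_onI lessThan_iff linorder_neqE_nat)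
      then have "card (g ` {..<n - 1}) = n - 1"
        by (simp add: card_image)
      moreover have "x \<notin> g ` {..<n - 1}" "y \<notin> g ` {..<n - 1}" "x \<noteq> y"
        using g(2) xy by (auto simp: \<alpha>_def)
      \<comment> \<open>The \<open>n - 1\<close> witnesses with \<open>r\<close> and the two worlds
        without it are one world too many.\<close>
      ultimately have "card (insert x (insert y (g ` {..<n - 1}))) = n + 1"
        using n by simp
      moreover have "card (insert x (insert y (g ` {..<n - 1}))) \<le> card W"
        using C g(1) xy by (intro card_mono) (auto simp: EQ_cond_def)
      ultimately show False
        using C by (simp add: EQ_cond_def)
    qed
    then show "holds W R V w (Imp \<phi> \<psi>)" by auto
  qed
  then obtain \<chi> where \<chi>: "Imp \<phi> \<chi> \<in> EQ n" "Imp \<chi> \<psi> \<in> EQ n" "sig \<chi> \<subseteq> sig \<phi> \<inter> sig \<psi>"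
    using craig unfolding craig_interpolation_def by blast
  have sig_\<chi>: "sig \<chi> \<subseteq> {r}"
    using \<chi>(3) by (auto simp: \<phi>_def \<psi>_def \<alpha>_def atoms)
  have valid: "holds {..<k} (full k) V 0 \<theta>" if "\<theta> \<in> EQ n" "0 < k" "k \<le> n" for \<theta> k V
    using that frame_full EQ_cond_full unfolding EQ_def logic_of_def by blast
  define U where "U i = (if i = 0 then {r} else {})" for i :: nat
  \<comment> \<open>Identifying all worlds with \<open>r\<close>, and all worlds without it, hides
    both \<open>c\<close> and \<open>k\<close> from \<open>\<chi>\<close>.\<close>
  have collapse: "holds {..<k} (full k) V 0 \<chi> \<longleftrightarrow> holds {..<2} (full 2) U 0 \<chi>"
    if c: "0 < c" "c < k" and V: "\<And>i. i < k \<Longrightarrow> r \<in> V i \<longleftrightarrow> i < c" for k c V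
  proof -
    let ?f = "\<lambda>i. if i < c then 0 else 1 :: nat"
    have "bounded_morphism {..<k} (full k) {..<2} (full 2) ?f"
      unfolding bounded_morphism_def
    proof (intro conjI ballI impI)
      fix v :: nat and a assume "a \<in> {..<k}" "v \<in> {..<2}"
      then show "\<exists>b\<in>{..<k}. (a, b) \<in> full k \<and> ?f b = v"
        \<comment> \<open>World \<open>c\<close> is the first one without \<open>r\<close>.\<close>
        using c by (intro bexI[of _ "if v = 0 then 0 else c"]) auto
    qed auto
    then have "holds {..<k} (full k) (U \<circ> ?f) 0 \<chi> \<longleftrightarrow> holds {..<2} (full 2) U (?f 0) \<chi>"
      by (rule holds_bounded_morphism) (use c in simp)
    moreover have "holds {..<k} (full k) (U \<circ> ?f) 0 \<chi> \<longleftrightarrow> holds {..<k} (full k) V 0 \<chi>"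
      by (rule holds_coincidence) (use sig_\<chi> V c in \<open>auto simp: U_def split: if_splits\<close>)
    ultimately show ?thesis using c by simp
  qed
  define V where "V i = (if i < n - 1 then {r, p i} else {})" for i
  have "holds {..<n} (full n) V i (\<alpha> i)" if "i < n - 1" for i
    using that by (auto simp: \<alpha>_def V_def atoms)
  then have "holds {..<n} (full n) V 0 \<phi>"
    using n by (fastforce simp: \<phi>_def)
  then have "holds {..<n} (full n) V 0 \<chi>"
    using valid[OF \<chi>(1), of n V] n by simp
  then have "holds {..<2} (full 2) U 0 \<chi>"
    using collapse[of "n - 1" n V] n by (auto simp: V_def)
  \<comment> \<open>Worlds 1 and 2 lack \<open>r\<close> and differ on \<open>q\<close>; these three
    worlds fit because \<open>3 \<le> n\<close>.\<close>
  moreover define V' where "V' i = (if i = 0 then {r} else if i = 1 then {q} else {})" for i :: nat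
  ultimately have "holds {..<3} (full 3) V' 0 \<chi>"
    using collapse[of 1 3 V'] by (auto simp: V'_def atoms)
  then have "holds {..<3} (full 3) V' 0 \<psi>"
    using valid[OF \<chi>(2), of 3 V'] n by simp
  moreover have "\<exists>i<3. r \<notin> V' i \<and> q \<in> V' i" "\<exists>i<3. r \<notin> V' i \<and> q \<notin> V' i"
    by (rule exI[of _ 1], simp add: V'_def atoms, rule exI[of _ 2], simp add: V'_def atoms)
  ultimately show False
    by (auto simp: \<psi>_def)
qed

section \<open>Strict linear orders\<close>

abbreviation chain :: "nat \<Rightarrow> (nat \<times> nat) set" where
  "chain k \<equiv> {(i, j). i < j \<and> j < k}"

lemma LO_cond_chain:
  assumes "k \<le> n"
  shows "LO_cond n {..<k} (chain k)"
proof -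
  have "no_infinite_chain (chain k)"
    unfolding no_infinite_chain_def
  proof
    assume "\<exists>f. \<forall>i. (f i, f (Suc i)) \<in> chain k"
    then obtain f :: "nat \<Rightarrow> nat" where f: "f i < f (Suc i)" "f (Suc i) < k" for i by auto
    have "i \<le> f i" for i
      using f(1) by (simp add: strict_mono_Suc_iff strict_mono_imp_increasing)
    from this[of "Suc k"] f(2)[of k] show False by simp
  qed
  moreover have "length ws \<le> n"
    if "set ws \<subseteq> {..<k}" "successively (\<lambda>w v. (w, v) \<in> chain k) ws" for ws
  proof -
    have "successively (<) ws" using that(2) by (rule successively_mono) auto
    then have "distinct ws"
      by (simp add: successively_conv_sorted_wrt strict_sorted_iff)
    then have "length ws = card (set ws)" by (simp add: distinct_card)
    also have "\<dots> \<le> k" using card_mono[OF _ that(1)] by simp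
    finally show ?thesis using assms by simp
  qed
  ultimately show ?thesis
    by (auto simp: LO_cond_def length_at_most_def trans_def)
qed

text \<open>Insertion: worlds below \<open>a\<close> go before it and the remaining ones after it;
  transitivity through \<open>a\<close> keeps the list sorted.\<close>

lemma sorted_list_if_total:
  assumes "trans R" and "finite S"
    and "\<And>w v. w \<in> S \<Longrightarrow> v \<in> S \<Longrightarrow> (w, v) \<in> R \<or> (v, w) \<in> R \<or> w = v"
  shows "\<exists>ws. sorted_wrt (\<lambda>w v. (w, v) \<in> R) ws \<and> set ws = S"
  using assms(2,3)
proof (induction S)
  case (insert a S)
  then obtain ws where ws: "sorted_wrt (\<lambda>w v. (w, v) \<in> R) ws" "set ws = S"
    by auto
  let ?vs = "filter (\<lambda>w. (w, a) \<in> R) ws @ a # filter (\<lambda>w. (a, w) \<in> R \<and> (w, a) \<notin> R) ws"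
  have "sorted_wrt (\<lambda>w v. (w, v) \<in> R) ?vs"
    using ws(1) assms(1) by (auto simp: sorted_wrt_append sorted_wrt_filter dest: transD)
  moreover have "set ?vs = insert a S"
    using ws(2) insert by auto
  ultimately show ?case by blast
qed simp

text \<open>The root and its successors, listed in order, form a chain. Its length varies with
  \<open>w\<close> and cannot be padded as for equivalence relations, since formulas detect it;
  hence a range of values for \<open>k\<close>.\<close>

lemma LO_cond_bounded_morphism:
  assumes fr: "frame W R" and C: "LO_cond n W R" and w: "w \<in> W"
  shows "\<exists>k\<in>{1..n}. \<exists>f. f 0 = w \<and> bounded_morphism {..<k} (chain k) W R f"
proof -
  have R: "R \<subseteq> W \<times> W" "trans R"
    and total: "\<And>w v. w \<in> W \<Longrightarrow> v \<in> W \<Longrightarrow> (w, v) \<in> R \<or> (v, w) \<in> R \<or> w = v"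
    using fr C by (auto simp: frame_def LO_cond_def)
  have irrefl: "(x, x) \<notin> R" for x
  proof
    assume "(x, x) \<in> R"
    then have "\<exists>f :: nat \<Rightarrow> _. \<forall>i. (f i, f (Suc i)) \<in> R"
      by (intro exI[of _ "\<lambda>_. x"]) simp
    then show False
      using C by (simp add: LO_cond_def no_infinite_chain_def)
  qed
  have sub: "R `` {w} \<subseteq> W" using R(1) by auto
  then obtain vs where vs: "sorted_wrt (\<lambda>w v. (w, v) \<in> R) vs" "set vs = R `` {w}"
    using sorted_list_if_total[OF R(2) finite_subset[OF sub LO_cond_finite[OF C]]] total by blast
  define ws where "ws = w # vs"
  have sorted: "sorted_wrt (\<lambda>w v. (w, v) \<in> R) ws" and set_ws: "set ws = insert w (R `` {w})"
    using vs by (auto simp: ws_def)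
  have "length ws \<le> n"
    using C successively_if_sorted_wrt[OF sorted] set_ws sub w
    by (auto simp: LO_cond_def length_at_most_def)
  moreover have "bounded_morphism {..<length ws} (chain (length ws)) W R (nth ws)"
    unfolding bounded_morphism_def
  proof (intro conjI ballI impI)
    show "nth ws ` {..<length ws} \<subseteq> W"
      using set_ws sub w nth_mem[of _ ws] by auto
    show "(ws ! i, ws ! j) \<in> R" if "(i, j) \<in> chain (length ws)" for i j
      using sorted that by (auto simp: sorted_wrt_iff_nth_less)
    fix i v assume i: "i \<in> {..<length ws}" and v: "(ws ! i, v) \<in> R"
    have "ws ! i \<in> insert w (R `` {w})"
      using i set_ws nth_mem[of i ws] by auto
    then have "v \<in> set ws"
      using v set_ws R(2) by (auto dest: transD)
    then obtain j where j: "j < length ws" "ws ! j = v"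
      by (auto simp: in_set_conv_nth)
    \<comment> \<open>Otherwise sortedness would place \<open>v\<close> below or at
      \<open>ws ! i\<close>, giving a loop by transitivity.\<close>
    have "i < j"
    proof (rule ccontr)
      assume "\<not> i < j"
      then have "(v, ws ! i) \<in> R \<or> v = ws ! i"
        using sorted i j by (cases "i = j") (auto simp: sorted_wrt_iff_nth_less)
      then show False
        using v irrefl R(2) by (metis transD)
    qed
    then show "\<exists>j\<in>{..<length ws}. (i, j) \<in> chain (length ws) \<and> ws ! j = v"
      using j by auto
  qed
  ultimately show ?thesis
    by (intro bexI[of _ "length ws"] exI[of _ "nth ws"]) (auto simp: ws_def)
qed

text \<open>The formula forbids paths of \<open>m\<close> steps, and the longest path from
  \<open>i\<close> has \<open>k - i - 1\<close> steps. It thus measures height without any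
  atoms.\<close>

lemma holds_chain_Box_Falsum:
  "i < k \<Longrightarrow> holds {..<k} (chain k) V i ((Box ^^ m) (Neg Truth)) \<longleftrightarrow> k \<le> i + m"
proof (induction m arbitrary: i)
  case (Suc m)
  have "holds {..<k} (chain k) V i ((Box ^^ Suc m) (Neg Truth)) \<longleftrightarrow> (\<forall>j. i < j \<and> j < k \<longrightarrow> k \<le> j + m)"
    using Suc.IH by auto
  also have "\<dots> \<longleftrightarrow> k \<le> i + Suc m"
  proof
    assume "\<forall>j. i < j \<and> j < k \<longrightarrow> k \<le> j + m"
    \<comment> \<open>The next world gives the strongest bound; if there is none, then
      \<open>k \<le> Suc i\<close> suffices.\<close>
    from this[rule_format, of "Suc i"] show "k \<le> i + Suc m" by linarith
  qed auto
  finally show ?case .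
qed simp

lemma sig_Box_Falsum: "sig ((Box ^^ m) (Neg Truth)) = {}"
  by (induction m) auto

lemma uniform_interpolation_LO: "uniform_interpolation (LO n :: 'a fm set)"
  unfolding LO_def
proof (rule uniform_interpolation_if_canonical[where K = "{1..n}" and Rel = chain])
  show "frame {..<k} (chain k) \<and> LO_cond n {..<k} (chain k)" if "k \<in> {1..n}" for k
    using that LO_cond_chain[of k n] by (auto simp: frame_def lessThan_empty_iff)
next
  fix k k' :: nat and V V' :: "nat \<Rightarrow> 'a set" and \<tau> :: "'a set"
  assume k: "k \<in> {1..n}" "k' \<in> {1..n}"
    and eq: "\<And>\<theta> :: 'a fm. sig \<theta> \<subseteq> \<tau> \<Longrightarrow>
      holds {..<k} (chain k) V 0 \<theta> \<longleftrightarrow> holds {..<k'} (chain k') V' 0 \<theta>"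
  \<comment> \<open>Atom-free formulas at the root already determine the length of the
    chain.\<close>
  have "k \<le> m \<longleftrightarrow> k' \<le> m" for m
    using eq[of "(Box ^^ m) (Neg Truth)"] k
      holds_chain_Box_Falsum[of 0 k V m] holds_chain_Box_Falsum[of 0 k' V' m]
    by (simp add: sig_Box_Falsum)
  then have [simp]: "k' = k" by (meson order_antisym order_refl)
  have "p \<in> V i \<longleftrightarrow> p \<in> V' i" if "p \<in> \<tau>" "i < k" for p i
  \<comment> \<open>The irreflexive root is invisible to \<open>Dia\<close> and is read off
    directly.\<close>
  proof (cases "i = 0")
    case True
    then show ?thesis using eq[of "Atom p"] that by simp
  next
    case False
    \<comment> \<open>World \<open>i\<close> is the only one with exactly \<open>k - i - 1\<close> worlds above it.\<close>
    define \<beta> :: "'a fm" where "\<beta> = Conj (Atom p)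
      (Conj ((Box ^^ (k - i)) (Neg Truth)) (Neg ((Box ^^ (k - i - 1)) (Neg Truth))))"
    have \<beta>: "holds {..<k} (chain k) U j \<beta> \<longleftrightarrow> j = i \<and> p \<in> U i" if "j < k" for U j
    proof -
      \<comment> \<open>As \<open>i < k\<close>, neither subtraction is truncated.\<close>
      have "k \<le> j + (k - i) \<and> \<not> k \<le> j + (k - i - 1) \<longleftrightarrow> j = i"
        using that \<open>i < k\<close> by arith
      then show ?thesis
        using holds_chain_Box_Falsum[OF that] by (auto simp: \<beta>_def simp del: One_nat_def)
    qed
    have "holds {..<k} (chain k) U 0 (Dia \<beta>) \<longleftrightarrow> p \<in> U i" for U
      using \<beta> False \<open>i < k\<close> by auto
    moreover have "sig (Dia \<beta>) \<subseteq> \<tau>"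
      using that by (simp add: \<beta>_def sig_Box_Falsum)
    ultimately show ?thesis using eq[of "Dia \<beta>"] by simp
  qed
  then show "k = k' \<and> (\<forall>i<k. V i \<inter> \<tau> = V' i \<inter> \<tau>)" by auto
qed (simp, rule LO_cond_bounded_morphism)

theorem theoremE2:
  assumes "infinite (UNIV :: 'a set)"
  shows "uniform_interpolation (EQ 1 :: 'a fm set)
    \<and> uniform_interpolation (EQ 2 :: 'a fm set)
    \<and> (\<forall>n\<ge>3. \<not> craig_interpolation (EQ n :: 'a fm set))
    \<and> (\<forall>n\<ge>1. uniform_interpolation (LO n :: 'a fm set))"
  by (simp add: uniform_interpolation_EQ not_craig_interpolation_EQ[OF assms] uniform_interpolation_LO)

end
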